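(* Let $\Omega$ be a Polish space with Borel $\sigma$-field $\mathfrak{B}$, let $\Theta$ be the set of all probability measures on $(\Omega,\mathfrak{B})$, and let $\Theta_0,\Theta_1\subset\Theta$. Let $X_1,\ldots,X_n$ be i.i.d. with law $P\in\Theta$, and consider testing $H_0:P\in\Theta_0$ versus $H_1:P\in\Theta_1$. Write $\mathrm{cl}_c(\Psi)$ for the closure of $\Psi\subset\Theta$ in the weak topology. Then: (i) If $\Theta_0$ and $\Theta_1$ are both relatively compact in the $\tau$-topology and $\mathrm{cl}_c(\Theta_0)\cap\mathrm{cl}_c(\Theta_1)\ne\emptyset$, then $H_0$ and $H_1$ are indistinguishable. (ii) If $\Theta_0$ or $\Theta_1$ is relatively compact in the weak topology and $\mathrm{cl}_c(\Theta_0)\cap\mathrm{cl}_c(\Theta_1)=\emptyset$, then $H_0$ and $H_1$ are distinguishable. Moreover, there exist a sequence of tests $K_n=K_n(X_1,\ldots,X_n)$, a constant $c>0$ and a constant $n_0$ such that for all $n>n_0$ $$\alpha(K_n)\le\exp\{-cn\}\quad\text{and}\quad\beta(K_n)\le\exp\{-cn\}.$$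
   Context: The weak topology on $\Theta$ is the one generated by the maps $P\mapsto\int_\Omega f\,dP$ with $f:\Omega\to\mathbb{R}$ bounded and continuous. The $\tau$-topology on $\Theta$ is the coarsest topology for which all maps $P\mapsto P(B)$, $B\in\mathfrak{B}$, are continuous. A set is relatively compact in a topology on $\Theta$ if its closure in $\Theta$ in that topology is compact. A test based on $n$ observations is a measurable function $K_n:(\Omega^n,\mathfrak{B}^{n})\to[0,1]$ (the value is the probability of rejecting $H_0$). Its error probabilities are $\alpha(K_n)=\sup_{P\in\Theta_0}E_P[K_n]$ and $\beta(K_n)=\sup_{P\in\Theta_1}E_P[1-K_n]$, where $E_P$ is expectation for $X_1,\ldots,X_n$ i.i.d. with law $P$. $H_0$ and $H_1$ are distinguishable if there are uniformly consistent tests: for every $0<\alpha<1$ there are tests $K_n$, $n=1,2,\ldots$, with $\alpha(K_n)<\alpha$ and $\lim_{n\to\infty}\beta(K_n)=0$. They are indistinguishable if $\alpha(K_n)+\beta(K_n)\ge1$ for every $n$ and every test $K_n$. *)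

theory Defs
  imports "HOL-Probability.Probability"
begin

definition prob_measures :: "'a::topological_space measure set" where
  "prob_measures = {P. prob_space P \<and> sets P = sets borel}"

definition weak_topology :: "'a::topological_space measure topology" where
  "weak_topology = topology_generated_by
     {{P \<in> prob_measures. integral\<^sup>L P f \<in> U} | (f :: 'a \<Rightarrow> real) U.
        continuous_on UNIV f \<and> bounded (range f) \<and> open U}"

definition tau_topology :: "'a::topological_space measure topology" where
  "tau_topology = topology_generated_by
     {{P \<in> prob_measures. measure P B \<in> U} | (B :: 'a set) (U :: real set).
        B \<in> sets borel \<and> open U}"

definition relatively_compact_in :: "'b topology \<Rightarrow> 'b set \<Rightarrow> bool" where
  "relatively_compact_in X S \<longleftrightarrow> compactin X (X closure_of S)"

lemma topspace_weak_topology [simp]: "topspace weak_topology = prob_measures"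
proof -
  have "prob_measures \<in> {{P \<in> prob_measures. integral\<^sup>L P f \<in> U} | (f :: 'a \<Rightarrow> real) U.
        continuous_on UNIV f \<and> bounded (range f) \<and> open U}"
    by (rule CollectI, rule exI[of _ "\<lambda>_. 0"], rule exI[of _ UNIV]) auto
  then show ?thesis
    unfolding weak_topology_def by auto
qed

lemma topspace_tau_topology [simp]: "topspace tau_topology = prob_measures"
proof -
  have "prob_measures \<in> {{P \<in> prob_measures. measure P B \<in> U} | (B :: 'a set) (U :: real set).
        B \<in> sets borel \<and> open U}"
    by (rule CollectI, rule exI[of _ "{}"], rule exI[of _ UNIV]) auto
  then show ?thesis
    unfolding tau_topology_def by auto
qed

text \<open>
  A sample of size \<open>n\<close> is a function \<open>x\<close> on \<open>{1..n}\<close>, so the observations are \<open>x 1, \<dots>, x n\<close>;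
  their joint law for i.i.d. observations with law \<open>P\<close> is the product measure.
\<close>

definition is_test :: "nat \<Rightarrow> ((nat \<Rightarrow> 'a::topological_space) \<Rightarrow> real) \<Rightarrow> bool" where
  "is_test n K \<longleftrightarrow>
     K \<in> borel_measurable (PiM {1..n} (\<lambda>_. borel)) \<and>
     (\<forall>x \<in> space (PiM {1..n} (\<lambda>_. borel :: 'a measure)). 0 \<le> K x \<and> K x \<le> 1)"

text \<open>
  The error probabilities take values in \<^typ>\<open>ennreal\<close>, so that the supremum over an empty
  hypothesis is \<open>0\<close>.
\<close>

definition type1_error ::
    "'a::topological_space measure set \<Rightarrow> nat \<Rightarrow> ((nat \<Rightarrow> 'a) \<Rightarrow> real) \<Rightarrow> ennreal" where
  "type1_error \<Theta>0 n K = (SUP P\<in>\<Theta>0. \<integral>\<^sup>+x. ennreal (K x) \<partial>PiM {1..n} (\<lambda>_. P))"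

definition type2_error ::
    "'a::topological_space measure set \<Rightarrow> nat \<Rightarrow> ((nat \<Rightarrow> 'a) \<Rightarrow> real) \<Rightarrow> ennreal" where
  "type2_error \<Theta>1 n K = (SUP P\<in>\<Theta>1. \<integral>\<^sup>+x. ennreal (1 - K x) \<partial>PiM {1..n} (\<lambda>_. P))"

definition distinguishable ::
    "'a::topological_space measure set \<Rightarrow> 'a measure set \<Rightarrow> bool" where
  "distinguishable \<Theta>0 \<Theta>1 \<longleftrightarrow>
     (\<forall>a::real. 0 < a \<and> a < 1 \<longrightarrow>
        (\<exists>K. (\<forall>n\<ge>1. is_test n (K n) \<and> type1_error \<Theta>0 n (K n) < ennreal a) \<and>
             (\<lambda>n. type2_error \<Theta>1 n (K n)) \<longlonglongrightarrow> 0))"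

definition indistinguishable ::
    "'a::topological_space measure set \<Rightarrow> 'a measure set \<Rightarrow> bool" where
  "indistinguishable \<Theta>0 \<Theta>1 \<longleftrightarrow>
     (\<forall>n\<ge>1. \<forall>K. is_test n K \<longrightarrow> type1_error \<Theta>0 n K + type2_error \<Theta>1 n K \<ge> 1)"

end

theory Submission
  imports Defs
begin

text \<open>
  \<^bold>\<open>Indistinguishable hypotheses.\<close>  The error probabilities of a test \<open>K\<close> of sample size \<open>n\<close> are
  governed by \<open>P \<mapsto> E\<^sub>P K\<close>, the integral of \<open>K\<close> against the \<open>n\<close>-fold power of \<open>P\<close>.  If this map
  were \<open>\<tau>\<close>-continuous, a common \<open>\<tau>\<close>-limit \<open>P\<close> of both hypotheses would give
  \<open>\<alpha>(K) + \<beta>(K) \<ge> E\<^sub>P K + E\<^sub>P (1 - K) = 1\<close>.  For \<open>n \<ge> 2\<close> it need not be continuous on all laws, but it is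
  continuous on every \<open>\<tau>\<close>-compact set \<open>C\<close>.  By Dini's argument such a \<open>C\<close> is uniformly countably
  additive: \<open>sup {P(B\<^sub>k) | P \<in> C} \<rightarrow> 0\<close> whenever \<open>B\<^sub>k\<close> decreases to \<open>\<emptyset>\<close>.  The powers of the laws in \<open>C\<close> inherit
  this by integrating over sections (\<open>uniformly_countably_additive_power\<close>), and then the events whose
  power probability is continuous on \<open>C\<close> form a Dynkin system containing the rectangles
  (\<open>continuous_map_power_measure\<close>).  Bounded measurable functions follow by uniform approximation.
  The hypothesis is about weak closures, and these lie in the \<open>\<tau>\<close>-closures: a \<open>\<tau>\<close>-compact set
  is weakly compact, hence weakly closed because the weak topology is Hausdorff
  (\<open>weak_closure_subset_tau_closure\<close>).

  \<^bold>\<open>Distinguishable hypotheses.\<close>  If the weak closure of \<open>\<Theta>0\<close> is compact and misses that of \<open>\<Theta>1\<close>, it is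
  covered by finitely many basic weak neighbourhoods, each cut out by finitely many bounded
  continuous functions, and \<open>\<Theta>1\<close> stays out of the concentric neighbourhoods of twice the radius
  (\<open>compact_weak_separation\<close>).  The test that compares the empirical means of these functions with a
  radius half-way in between errs only if one of finitely many empirical means of bounded variables
  deviates from its expectation by a fixed amount, which by Hoeffding's inequality has exponentially
  small probability, uniformly in the law.  The case of compact \<open>\<Theta>1\<close> follows by exchanging the
  hypotheses and replacing \<open>K\<close> by \<open>1 - K\<close>.
\<close>

section \<open>Uniform countable additivity\<close>

text \<open>
  The family is indexed by \<open>C\<close> through \<open>Q\<close>, so that the same notion applies to a set of laws
  (\<open>Q\<close> the identity) and to their powers. The measure \<open>M\<close> only supplies the \<open>\<sigma>\<close>-algebra.
\<close>

definition uniformly_countably_additive :: "'b measure \<Rightarrow> 'i set \<Rightarrow> ('i \<Rightarrow> 'b measure) \<Rightarrow> bool" where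
  "uniformly_countably_additive M C Q \<longleftrightarrow>
     (\<forall>B. range B \<subseteq> sets M \<longrightarrow> decseq B \<longrightarrow> (\<Inter>k. B k) = {} \<longrightarrow>
        (\<forall>e>0. \<exists>k::nat. \<forall>P\<in>C. measure (Q P) (B k) < e))"

lemma uniformly_countably_additiveD:
  assumes "uniformly_countably_additive M C Q" "range B \<subseteq> sets M" "decseq B" "(\<Inter>k. B k) = {}" "e > 0"
  obtains k :: nat where "\<And>P. P \<in> C \<Longrightarrow> measure (Q P) (B k) < e"
  using assms unfolding uniformly_countably_additive_def by metis

lemma uniformly_countably_additive_subset:
  "uniformly_countably_additive M C Q \<Longrightarrow> D \<subseteq> C \<Longrightarrow> uniformly_countably_additive M D Q"
  unfolding uniformly_countably_additive_def by (meson subsetD)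

lemma openin_tau_topology_basic:
  "B \<in> sets borel \<Longrightarrow> open U \<Longrightarrow> openin tau_topology {P \<in> prob_measures. measure P B \<in> U}"
  unfolding tau_topology_def by (rule topology_generated_by_Basis) blast

lemma continuous_map_measure_tau:
  "B \<in> sets borel \<Longrightarrow> continuous_map tau_topology euclideanreal (\<lambda>P. measure P B)"
  by (simp add: continuous_map_def openin_tau_topology_basic)

text \<open>
  Dini's argument: the continuous functions \<open>P \<mapsto> P(B\<^sub>k)\<close> decrease pointwise to \<open>0\<close>, so the open sets
  \<open>{P. P(B\<^sub>k) < e}\<close> increase with \<open>k\<close> and cover \<open>C\<close>.
\<close>

lemma tau_compact_imp_uniformly_countably_additive:
  fixes C :: "'a::topological_space measure set"
  assumes C: "compactin tau_topology C"
  shows "uniformly_countably_additive borel C (\<lambda>P. P)"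
  unfolding uniformly_countably_additive_def
proof (intro allI impI)
  fix B :: "nat \<Rightarrow> 'a set" and e :: real
  assume B: "range B \<subseteq> sets borel" and dec: "decseq B" and B0: "(\<Inter>k. B k) = {}" and e: "e > 0"
  define U where "U k = {P \<in> prob_measures. measure P (B k) \<in> {..<e}}" for k
  have "openin tau_topology (U k)" for k
    unfolding U_def using B by (intro openin_tau_topology_basic) auto
  moreover have "C \<subseteq> \<Union>(range U)"
  proof
    fix P assume "P \<in> C"
    then have P: "P \<in> prob_measures"
      using C compactin_subset_topspace by fastforce
    then interpret prob_space P by (simp add: prob_measures_def)
    have "(\<lambda>k. measure P (B k)) \<longlonglongrightarrow> measure P (\<Inter>k. B k)"
      using P B dec by (intro finite_Lim_measure_decseq) (auto simp: prob_measures_def)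
    then have "\<forall>\<^sub>F k in sequentially. measure P (B k) < e"
      using B0 e by (intro order_tendstoD) auto
    then obtain k where "measure P (B k) < e"
      using eventually_happens'[OF sequentially_bot] by blast
    then show "P \<in> \<Union>(range U)"
      using P by (auto simp: U_def)
  qed
  ultimately obtain F where F: "finite F" "F \<subseteq> range U" "C \<subseteq> \<Union>F"
    using compactinD[OF C, of "range U"] by blast
  then obtain K where K: "finite K" "F = U ` K"
    by (meson finite_subset_image)
  have "measure P (B (Max (insert 0 K))) < e" if "P \<in> C" for P
  proof -
    obtain k where k: "k \<in> K" "P \<in> U k"
      using F K \<open>P \<in> C\<close> by blast
    then interpret prob_space P by (simp add: prob_measures_def U_def)
    have "B (Max (insert 0 K)) \<subseteq> B k"
      using k K by (intro decseqD[OF dec]) auto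
    moreover have "B k \<in> sets P"
      using B k by (auto simp: U_def prob_measures_def)
    ultimately have "measure P (B (Max (insert 0 K))) \<le> measure P (B k)"
      by (rule finite_measure_mono)
    then show ?thesis
      using k by (auto simp: U_def)
  qed
  then show "\<exists>k. \<forall>P\<in>C. measure P (B k) < e" by blast
qed

text \<open>
  Induction on the number of coordinates. If \<open>B\<^sub>k\<close> decreases to \<open>\<emptyset>\<close>, so do the sections of \<open>B\<^sub>k\<close> at
  each \<open>x\<close>, hence \<open>g\<^sub>k(x)\<close>, the supremum over \<open>P \<in> C\<close> of the probability of the section, tends to \<open>0\<close>. The sets
  \<open>E\<^sub>k = {g\<^sub>k \<ge> e/2}\<close> therefore decrease to \<open>\<emptyset>\<close> as well, and the probability of \<open>B\<^sub>k\<close> is at most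
  \<open>P(E\<^sub>k) + e/2\<close>. Countability of \<open>C\<close> is what makes the supremum \<open>g\<^sub>k\<close> measurable.
\<close>

lemma uniformly_countably_additive_power_countable:
  fixes M :: "'a measure" and C :: "'a measure set"
  assumes "finite I" "countable C"
    and C: "\<And>P. P \<in> C \<Longrightarrow> prob_space P \<and> sets P = sets M"
    and uca: "uniformly_countably_additive M C (\<lambda>P. P)"
  shows "uniformly_countably_additive (PiM I (\<lambda>_. M)) C (\<lambda>P. PiM I (\<lambda>_. P))"
  using \<open>finite I\<close>
proof (induction I rule: finite_induct)
  case empty
  show ?case
    unfolding uniformly_countably_additive_def
  proof (intro allI impI)
    fix B :: "nat \<Rightarrow> ('b \<Rightarrow> 'a) set" and e :: real
    assume B: "range B \<subseteq> sets (PiM {} (\<lambda>_. M))" and B0: "(\<Inter>k. B k) = {}" and e: "e > 0"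
    then obtain k where "(\<lambda>_. undefined) \<notin> B k" by blast
    moreover have "B k \<subseteq> {\<lambda>_. undefined}"
      using sets.sets_into_space[of "B k" "PiM {} (\<lambda>_. M)"] B by (auto simp: space_PiM)
    ultimately have "B k = {}" by blast
    then show "\<exists>k. \<forall>P\<in>C. measure (PiM {} (\<lambda>_. P)) (B k) < e"
      using e by (intro exI[of _ k]) auto
  qed
next
  case (insert i I)
  show ?case
    unfolding uniformly_countably_additive_def
  proof (intro allI impI)
    fix B :: "nat \<Rightarrow> ('b \<Rightarrow> 'a) set" and e :: real
    assume B: "range B \<subseteq> sets (PiM (insert i I) (\<lambda>_. M))" and dec: "decseq B"
      and B0: "(\<Inter>k. B k) = {}" and e: "e > 0"
    have B' [measurable]: "B k \<in> sets (PiM (insert i I) (\<lambda>_. M))" for k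
      using B by blast
    have setsI: "sets (PiM J (\<lambda>_. P)) = sets (PiM J (\<lambda>_. M))" if "P \<in> C" for P and J :: "'b set"
      using C[OF that] by (intro sets_PiM_cong) auto
    define S where "S k x = {y \<in> space (PiM I (\<lambda>_. M)). y(i := x) \<in> B k}" for k x
    have S_sets: "S k x \<in> sets (PiM I (\<lambda>_. M))" if [measurable]: "x \<in> space M" for k x
      unfolding S_def by measurable
    define g where "g k x = (SUP P\<in>C. emeasure (PiM I (\<lambda>_. P)) (S k x))" for k x
    have section_integral: "emeasure (PiM I (\<lambda>_. P)) (S k x) =
        (\<integral>\<^sup>+y. indicator (B k) (y(i := x)) \<partial>PiM I (\<lambda>_. P))"
      if "P \<in> C" "x \<in> space M" for P k x
    proof -
      have "space (PiM I (\<lambda>_. P)) = space (PiM I (\<lambda>_. M))"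
        using setsI[OF that(1)] by (rule sets_eq_imp_space_eq)
      then have "(\<integral>\<^sup>+y. indicator (B k) (y(i := x)) \<partial>PiM I (\<lambda>_. P)) =
          (\<integral>\<^sup>+y. indicator (S k x) y \<partial>PiM I (\<lambda>_. P))"
        by (intro nn_integral_cong) (auto simp: S_def split: split_indicator)
      then show ?thesis
        using S_sets[OF that(2)] setsI[OF that(1)] by simp
    qed
    have meas: "(\<lambda>x. \<integral>\<^sup>+y. indicator (B k) (y(i := x)) \<partial>PiM I (\<lambda>_. P)) \<in> borel_measurable M"
      if "P \<in> C" for P k
    proof -
      interpret prob_space P using C[OF that] by blast
      interpret product_prob_space "\<lambda>_. P" I by unfold_locales
      have [measurable_cong]: "sets (PiM I (\<lambda>_. P)) = sets (PiM I (\<lambda>_. M))"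
        using setsI[OF that] .
      have "sigma_finite_measure (PiM I (\<lambda>_. P))"
        by (intro prob_space_imp_sigma_finite prob_space_PiM) unfold_locales
      then show ?thesis
        by (intro sigma_finite_measure.borel_measurable_nn_integral) measurable
    qed
    have g_meas [measurable]: "g k \<in> borel_measurable M" for k
    proof -
      have "(\<lambda>x. SUP P\<in>C. (\<integral>\<^sup>+y. indicator (B k) (y(i := x)) \<partial>PiM I (\<lambda>_. P))) \<in> borel_measurable M"
        using \<open>countable C\<close> meas by (intro borel_measurable_SUP)
      also have "?this \<longleftrightarrow> ?thesis"
        unfolding g_def using section_integral by (intro measurable_cong SUP_cong) auto
      finally show ?thesis .
    qed
    define E where "E k = {x \<in> space M. g k x \<ge> ennreal (e / 2)}" for k
    have E_sets [measurable]: "E k \<in> sets M" for k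
      unfolding E_def by measurable
    have g_dec: "g l x \<le> g k x" if "k \<le> l" "x \<in> space M" for k l x
      unfolding g_def
    proof (rule SUP_mono)
      fix P assume P: "P \<in> C"
      have "S l x \<subseteq> S k x"
        using decseqD[OF dec that(1)] by (auto simp: S_def)
      then have "emeasure (PiM I (\<lambda>_. P)) (S l x) \<le> emeasure (PiM I (\<lambda>_. P)) (S k x)"
        using S_sets[OF that(2)] setsI[OF P] by (intro emeasure_mono) auto
      then show "\<exists>P'\<in>C. emeasure (PiM I (\<lambda>_. P)) (S l x) \<le> emeasure (PiM I (\<lambda>_. P')) (S k x)"
        using P by blast
    qed
    have "(\<Inter>k. E k) = {}"
    proof (rule ccontr)
      assume "(\<Inter>k. E k) \<noteq> {}"
      then obtain x where x: "\<And>k. x \<in> E k" by blast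
      then have xM: "x \<in> space M" by (auto simp: E_def)
      obtain k where k: "\<And>P. P \<in> C \<Longrightarrow> measure (PiM I (\<lambda>_. P)) (S k x) < e / 3"
      proof (rule uniformly_countably_additiveD[OF insert.IH, of "\<lambda>k. S k x" "e / 3"])
        show "range (\<lambda>k. S k x) \<subseteq> sets (PiM I (\<lambda>_. M))"
          using S_sets[OF xM] by blast
        show "decseq (\<lambda>k. S k x)"
          using dec by (auto simp: S_def decseq_def)
        show "(\<Inter>k. S k x) = {}"
          using B0 by (auto simp: S_def)
      qed (use e in auto)
      have "g k x \<le> ennreal (e / 3)"
        unfolding g_def
      proof (rule SUP_least)
        fix P assume P: "P \<in> C"
        interpret prob_space "PiM I (\<lambda>_. P)"
          using C[OF P] by (intro prob_space_PiM) auto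
        show "emeasure (PiM I (\<lambda>_. P)) (S k x) \<le> ennreal (e / 3)"
          unfolding emeasure_eq_measure using k[OF P] by (intro ennreal_leI) simp
      qed
      also have "\<dots> < ennreal (e / 2)"
        using e by (intro ennreal_lessI) auto
      finally show False
        using x[of k] by (auto simp: E_def)
    qed
    moreover have "decseq E"
    proof (intro decseq_SucI subsetI)
      fix k x assume "x \<in> E (Suc k)"
      then show "x \<in> E k"
        using g_dec[of k "Suc k" x] by (auto simp: E_def)
    qed
    moreover have "range E \<subseteq> sets M"
      using E_sets by blast
    ultimately obtain k where k: "\<And>P. P \<in> C \<Longrightarrow> measure P (E k) < e / 2"
      using uniformly_countably_additiveD[OF uca, of E "e / 2"] half_gt_zero[OF e] by metis
    have "measure (PiM (insert i I) (\<lambda>_. P)) (B k) < e" if P: "P \<in> C" for P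
    proof -
      interpret P: prob_space P using C[OF P] by blast
      interpret product_sigma_finite "\<lambda>_. P"
        by unfold_locales
      interpret J: prob_space "PiM (insert i I) (\<lambda>_. P)"
        by (rule prob_space_PiM) unfold_locales
      interpret I: prob_space "PiM I (\<lambda>_. P)"
        by (rule prob_space_PiM) unfold_locales
      have [measurable_cong]: "sets P = sets M" using C[OF P] by blast
      have sp: "space P = space M" using C[OF P] by (intro sets_eq_imp_space_eq) blast
      have BP [measurable]: "B k \<in> sets (PiM (insert i I) (\<lambda>_. P))"
        using setsI[OF P] B' by blast
      have "emeasure (PiM (insert i I) (\<lambda>_. P)) (B k) =
          (\<integral>\<^sup>+z. indicator (B k) z \<partial>PiM (insert i I) (\<lambda>_. P))"
        by simp
      also have "\<dots> = (\<integral>\<^sup>+x. \<integral>\<^sup>+y. indicator (B k) (y(i := x)) \<partial>PiM I (\<lambda>_. P) \<partial>P)"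
        using insert.hyps by (intro product_nn_integral_insert_rev) auto
      also have "\<dots> \<le> (\<integral>\<^sup>+x. indicator (E k) x + ennreal (e / 2) \<partial>P)"
      proof (rule nn_integral_mono)
        fix x assume "x \<in> space P"
        then have x: "x \<in> space M" by (simp add: sp)
        have "emeasure (PiM I (\<lambda>_. P)) (S k x) \<le> indicator (E k) x + ennreal (e / 2)"
        proof (cases "x \<in> E k")
          case True
          then show ?thesis
            using I.emeasure_le_1[of "S k x"] by (simp add: add_increasing2)
        next
          case False
          have "emeasure (PiM I (\<lambda>_. P)) (S k x) \<le> g k x"
            unfolding g_def using P by (rule SUP_upper)
          also have "\<dots> \<le> ennreal (e / 2)"
            using False x by (auto simp: E_def)
          finally show ?thesis
            using False by simp
        qed
        then show "(\<integral>\<^sup>+y. indicator (B k) (y(i := x)) \<partial>PiM I (\<lambda>_. P)) \<le> indicator (E k) x + ennreal (e / 2)"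
          using section_integral[OF P x] by simp
      qed
      also have "\<dots> = ennreal (measure P (E k) + e / 2)"
        using e by (simp add: nn_integral_add P.emeasure_eq_measure P.prob_space ennreal_plus)
      finally have "measure (PiM (insert i I) (\<lambda>_. P)) (B k) \<le> measure P (E k) + e / 2"
        using e by (simp add: J.emeasure_eq_measure flip: ennreal_plus)
      then show ?thesis
        using k[OF P] by simp
    qed
    then show "\<exists>k. \<forall>P\<in>C. measure (PiM (insert i I) (\<lambda>_. P)) (B k) < e"
      by blast
  qed
qed

text \<open>
  A failure of uniformity is witnessed by one law for each \<open>k\<close>, hence already within a countable
  subfamily.
\<close>

lemma uniformly_countably_additive_power:
  fixes M :: "'a measure" and C :: "'a measure set"
  assumes I: "finite I"
    and C: "\<And>P. P \<in> C \<Longrightarrow> prob_space P \<and> sets P = sets M"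
    and uca: "uniformly_countably_additive M C (\<lambda>P. P)"
  shows "uniformly_countably_additive (PiM I (\<lambda>_. M)) C (\<lambda>P. PiM I (\<lambda>_. P))"
proof (rule ccontr)
  assume "\<not> ?thesis"
  then obtain B and e :: real where B: "range B \<subseteq> sets (PiM I (\<lambda>_. M))" "decseq B" "(\<Inter>k. B k) = {}"
    and e: "e > 0" and bad: "\<forall>k::nat. \<exists>P\<in>C. \<not> measure (PiM I (\<lambda>_. P)) (B k) < e"
    unfolding uniformly_countably_additive_def not_all not_imp not_ex by auto
  then obtain p where p: "\<And>k. p k \<in> C" "\<And>k. \<not> measure (PiM I (\<lambda>_. p k)) (B k) < e"
    using bad by metis
  have "uniformly_countably_additive (PiM I (\<lambda>_. M)) (range p) (\<lambda>P. PiM I (\<lambda>_. P))"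
    using p C uniformly_countably_additive_subset[OF uca, of "range p"]
    by (intro uniformly_countably_additive_power_countable I) auto
  then obtain k where "\<And>P. P \<in> range p \<Longrightarrow> measure (PiM I (\<lambda>_. P)) (B k) < e"
    using uniformly_countably_additiveD[OF _ B e] by blast
  then show False
    using p(2) by blast
qed

section \<open>Continuity of product probabilities\<close>

lemma continuous_map_real_uniform_approx:
  fixes f :: "'b \<Rightarrow> real"
  assumes "\<And>e. e > 0 \<Longrightarrow> \<exists>g. continuous_map X euclideanreal g \<and> (\<forall>x\<in>topspace X. \<bar>g x - f x\<bar> < e)"
  shows "continuous_map X euclideanreal f"
proof -
  have "\<exists>g. continuous_map X euclideanreal g \<and> (\<forall>x\<in>topspace X. \<bar>g x - f x\<bar> < inverse (real (Suc m)))" for m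
    by (rule assms) simp
  then obtain g where g: "\<And>m. continuous_map X euclideanreal (g m)"
    "\<And>m x. x \<in> topspace X \<Longrightarrow> \<bar>g m x - f x\<bar> < inverse (real (Suc m))"
    by metis
  have "continuous_map X (Met_TC.mtopology :: real topology) f"
  proof (rule Met_TC.continuous_map_uniform_limit[where F = sequentially and f = g])
    show "\<forall>\<^sub>F \<xi> in sequentially. continuous_map X Met_TC.mtopology (g \<xi>)"
      using g(1) by simp
    fix e :: real assume "e > 0"
    then have "\<forall>\<^sub>F m in sequentially. inverse (real (Suc m)) < e"
      by (intro order_tendstoD[OF LIMSEQ_inverse_real_of_nat])
    then show "\<forall>\<^sub>F m in sequentially. \<forall>x\<in>topspace X. f x \<in> UNIV \<and> dist (g m x) (f x) < e"
      by eventually_elim (auto simp: dist_real_def intro: less_trans[OF g(2)])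
  qed simp
  then show ?thesis by simp
qed

text \<open>
  Rounding \<open>f\<close> down to a multiple of \<open>1/m\<close> changes its integral by at most \<open>1/m\<close>, whatever the
  probability measure, and the rounded function takes only finitely many values.
\<close>

lemma continuous_map_integral_bounded:
  fixes Q :: "'p \<Rightarrow> 'b measure" and f :: "'b \<Rightarrow> real"
  assumes Q: "\<And>p. p \<in> topspace X \<Longrightarrow> prob_space (Q p) \<and> sets (Q p) = sets N"
    and meas_cont: "\<And>A. A \<in> sets N \<Longrightarrow> continuous_map X euclideanreal (\<lambda>p. measure (Q p) A)"
    and f [measurable]: "f \<in> borel_measurable N"
    and bound: "\<And>x. x \<in> space N \<Longrightarrow> \<bar>f x\<bar> \<le> b"
  shows "continuous_map X euclideanreal (\<lambda>p. integral\<^sup>L (Q p) f)"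
proof (rule continuous_map_real_uniform_approx)
  fix e :: real assume e: "e > 0"
  define m where "m = 2 / e"
  have m: "m > 0" "1 / m < e" using e by (auto simp: m_def)
  \<comment> \<open>The values of the floor of \<open>m * f\<close> lie in \<open>Z\<close>; the margin \<open>1\<close> absorbs the rounding.\<close>
  define Z where "Z = {- \<lceil>m * b\<rceil> - 1..\<lceil>m * b\<rceil> + 1}"
  define A where "A j = {x \<in> space N. \<lfloor>m * f x\<rfloor> = j}" for j
  have A [measurable]: "A j \<in> sets N" for j
    unfolding A_def by measurable
  define \<phi> where "\<phi> x = (\<Sum>j\<in>Z. of_int j / m * indicator (A j) x)" for x
  have approx: "\<bar>\<phi> x - f x\<bar> \<le> 1 / m" if x: "x \<in> space N" for x
  proof -
    have "m * \<bar>f x\<bar> \<le> m * b"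
      using bound[OF x] m by (intro mult_left_mono) auto
    then have mb: "\<bar>m * f x\<bar> \<le> m * b" using m by (simp add: abs_mult)
    then have "\<lfloor>m * f x\<rfloor> \<in> Z"
      unfolding Z_def by (simp add: abs_le_iff) linarith
    then have "\<phi> x = of_int \<lfloor>m * f x\<rfloor> / m"
      unfolding \<phi>_def using x
      by (subst sum.remove[of _ "\<lfloor>m * f x\<rfloor>"]) (auto simp: A_def Z_def intro!: sum.neutral)
    then have "\<phi> x - f x = (of_int \<lfloor>m * f x\<rfloor> - m * f x) / m"
      using m by (simp add: field_simps)
    also have "\<bar>\<dots>\<bar> = \<bar>of_int \<lfloor>m * f x\<rfloor> - m * f x\<bar> / m"
      using m by simp
    also have "\<dots> \<le> 1 / m"
      using m by (intro divide_right_mono) linarith+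
    finally show ?thesis .
  qed
  have "continuous_map X euclideanreal (\<lambda>p. \<Sum>j\<in>Z. of_int j / m * measure (Q p) (A j))"
    by (intro continuous_map_sum continuous_map_real_mult_left meas_cont) (auto simp: Z_def)
  moreover have "\<bar>(\<Sum>j\<in>Z. of_int j / m * measure (Q p) (A j)) - integral\<^sup>L (Q p) f\<bar> < e"
    if p: "p \<in> topspace X" for p
  proof -
    interpret prob_space "Q p" using Q[OF p] by blast
    have [measurable_cong]: "sets (Q p) = sets N" using Q[OF p] by blast
    have sp: "space (Q p) = space N" using Q[OF p] by (intro sets_eq_imp_space_eq) blast
    have int_f: "integrable (Q p) f"
      using bound by (intro integrable_const_bound[where B = b]) (auto simp: sp)
    have int_A: "integrable (Q p) (\<lambda>x. of_int j / m * indicator (A j) x)" for j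
      by (intro integrable_mult_right integrable_real_indicator) (auto simp: less_top[symmetric])
    have int_\<phi>: "integrable (Q p) \<phi>"
      unfolding \<phi>_def by (intro Bochner_Integration.integrable_sum int_A)
    have "integral\<^sup>L (Q p) \<phi> = (\<Sum>j\<in>Z. of_int j / m * measure (Q p) (A j))"
      unfolding \<phi>_def using int_A by (simp add: Bochner_Integration.integral_sum)
    then have "\<bar>(\<Sum>j\<in>Z. of_int j / m * measure (Q p) (A j)) - integral\<^sup>L (Q p) f\<bar> =
        \<bar>\<integral>x. \<phi> x - f x \<partial>Q p\<bar>"
      using int_f int_\<phi> by simp
    also have "\<dots> \<le> (\<integral>x. \<bar>\<phi> x - f x\<bar> \<partial>Q p)"
      by (rule integral_abs_bound)
    also have "\<dots> \<le> (\<integral>x. 1 / m \<partial>Q p)"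
      using approx int_f int_\<phi> by (intro integral_mono) (auto simp: sp)
    also have "\<dots> < e" using m by (simp add: prob_space)
    finally show ?thesis .
  qed
  ultimately show "\<exists>g. continuous_map X euclideanreal g \<and>
      (\<forall>p\<in>topspace X. \<bar>g p - integral\<^sup>L (Q p) f\<bar> < e)"
    by blast
qed

text \<open>
  For a rectangle the power probability is a finite product of \<open>\<tau>\<close>-continuous functions. The step to
  countable disjoint unions is where compactness enters: uniform countable additivity of the powers
  makes the partial sums converge uniformly on \<open>C\<close>.
\<close>

lemma continuous_map_power_measure:
  fixes C :: "'a::topological_space measure set" and I :: "'i set"
  assumes C: "compactin tau_topology C" and I: "finite I"
    and A: "A \<in> sets (PiM I (\<lambda>_. borel))"
  shows "continuous_map (subtopology tau_topology C) euclideanreal (\<lambda>P. measure (PiM I (\<lambda>_. P)) A)"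
proof -
  define N where "N = PiM I (\<lambda>_. borel :: 'a measure)"
  have CP: "prob_space P \<and> sets P = sets borel" if "P \<in> C" for P
    using compactin_subset_topspace[OF C] that by (auto simp: prob_measures_def)
  have top: "topspace (subtopology tau_topology C) = C"
    using compactin_subset_topspace[OF C] by auto
  have prob: "prob_space (PiM I (\<lambda>_. P))" if "P \<in> C" for P
    using CP[OF that] by (intro prob_space_PiM) auto
  have setsN: "sets (PiM I (\<lambda>_. P)) = sets N" if "P \<in> C" for P
    unfolding N_def using CP[OF that] by (intro sets_PiM_cong) auto
  have spaceN: "space (PiM I (\<lambda>_. P)) = space N" if "P \<in> C" for P
    using setsN[OF that] by (rule sets_eq_imp_space_eq)
  have uca: "uniformly_countably_additive N C (\<lambda>P. PiM I (\<lambda>_. P))"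
    unfolding N_def using CP tau_compact_imp_uniformly_countably_additive[OF C] I
    by (intro uniformly_countably_additive_power) auto
  have sigma: "sets N = sigma_sets (\<Pi>\<^sub>E i\<in>I. space borel) (prod_algebra I (\<lambda>_. borel))"
    unfolding N_def by (rule sets_PiM)
  have space: "space N = (\<Pi>\<^sub>E i\<in>I. space borel)"
    unfolding N_def by (rule space_PiM)
  have "A \<in> sigma_sets (\<Pi>\<^sub>E i\<in>I. space borel) (prod_algebra I (\<lambda>_. borel))"
    using A sigma by (simp add: N_def)
  with Int_stable_prod_algebra prod_algebra_sets_into_space show ?thesis
  proof (induction rule: sigma_sets_induct_disjoint)
    case (basic A)
    then obtain X where X: "A = (\<Pi>\<^sub>E i\<in>I. X i)" "\<And>i. i \<in> I \<Longrightarrow> X i \<in> sets borel"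
      by (auto simp: prod_algebra_eq_finite[OF I])
    have "continuous_map (subtopology tau_topology C) euclideanreal (\<lambda>P. \<Prod>i\<in>I. measure P (X i))"
      using X I by (intro continuous_map_prod continuous_map_from_subtopology continuous_map_measure_tau)
    moreover have "(\<Prod>i\<in>I. measure P (X i)) = measure (PiM I (\<lambda>_. P)) A" if "P \<in> C" for P
    proof -
      interpret single: prob_space P using CP[OF that] by blast
      interpret finite_product_prob_space "\<lambda>_. P" I
        by unfold_locales (rule I)
      show ?thesis
        using X CP[OF that] by (simp add: prob_times)
    qed
    ultimately show ?case
      by (auto intro: continuous_map_eq simp: top)
  next
    case empty
    then show ?case by simp
  next
    case (compl A)
    have "continuous_map (subtopology tau_topology C) euclideanreal (\<lambda>P. 1 - measure (PiM I (\<lambda>_. P)) A)"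
      using compl by (intro continuous_map_diff) auto
    moreover have "1 - measure (PiM I (\<lambda>_. P)) A = measure (PiM I (\<lambda>_. P)) ((\<Pi>\<^sub>E i\<in>I. space borel) - A)"
      if "P \<in> C" for P
      using prob_space.prob_compl[OF prob[OF that], of A] compl(1) setsN[OF that] spaceN[OF that] sigma space
      by simp
    ultimately show ?case
      by (auto intro: continuous_map_eq simp: top)
  next
    case (union A)
    have A: "range A \<subseteq> sets N" using union(2) sigma by simp
    show ?case
    proof (rule continuous_map_real_uniform_approx)
      fix e :: real assume e: "e > 0"
      define T where "T k = (\<Union>i\<in>{k..}. A i)" for k :: nat
      obtain k where k: "\<And>P. P \<in> C \<Longrightarrow> measure (PiM I (\<lambda>_. P)) (T k) < e"
      proof (rule uniformly_countably_additiveD[OF uca])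
        show "range T \<subseteq> sets N"
          using A unfolding T_def by (auto intro!: sets.countable_UN')
        show "decseq T" unfolding T_def decseq_def by force
        show "(\<Inter>k. T k) = {}"
        proof (rule ccontr)
          assume "(\<Inter>k. T k) \<noteq> {}"
          then obtain x where x: "\<And>k. x \<in> T k" by blast
          obtain i where i: "x \<in> A i" using x[of 0] by (auto simp: T_def)
          obtain j where j: "j \<ge> Suc i" "x \<in> A j" using x[of "Suc i"] by (auto simp: T_def)
          show False
            using disjoint_family_onD[OF union(1), of i j] i j by auto
        qed
      qed (use e in auto)
      have "continuous_map (subtopology tau_topology C) euclideanreal
          (\<lambda>P. \<Sum>i<k. measure (PiM I (\<lambda>_. P)) (A i))"
        using union by (intro continuous_map_sum) auto
      moreover have "\<bar>(\<Sum>i<k. measure (PiM I (\<lambda>_. P)) (A i)) - measure (PiM I (\<lambda>_. P)) (\<Union>i. A i)\<bar> < e"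
        if P: "P \<in> C" for P
      proof -
        interpret prob_space "PiM I (\<lambda>_. P)" using prob[OF P] .
        have A': "A i \<in> sets (PiM I (\<lambda>_. P))" for i
          using A setsN[OF P] by auto
        have disj: "disjoint_family_on A {..<k}"
          using union(1) by (rule disjoint_family_on_mono[rotated]) auto
        have "(\<Union>i. A i) = (\<Union>i<k. A i) \<union> T k"
          unfolding T_def by auto (metis atLeast_iff lessThan_iff linorder_not_le)
        moreover have "(\<Union>i<k. A i) \<inter> T k = {}"
        proof -
          have "A i \<inter> A j = {}" if "i < k" "k \<le> j" for i j
            using disjoint_family_onD[OF union(1), of i j] that by simp
          then show ?thesis
            unfolding T_def by (simp add: disjoint_iff) blast
        qed
        moreover have "T k \<in> sets (PiM I (\<lambda>_. P))"
          unfolding T_def using A' by auto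
        ultimately have "measure (PiM I (\<lambda>_. P)) (\<Union>i. A i) =
            measure (PiM I (\<lambda>_. P)) (\<Union>i<k. A i) + measure (PiM I (\<lambda>_. P)) (T k)"
          using A' by (simp add: finite_measure_Union)
        also have "measure (PiM I (\<lambda>_. P)) (\<Union>i<k. A i) = (\<Sum>i<k. measure (PiM I (\<lambda>_. P)) (A i))"
          using A' disj by (intro finite_measure_finite_Union) auto
        finally show ?thesis
          using k[OF P] by simp
      qed
      ultimately show "\<exists>g. continuous_map (subtopology tau_topology C) euclideanreal g \<and>
          (\<forall>P\<in>topspace (subtopology tau_topology C).
             \<bar>g P - measure (PiM I (\<lambda>_. P)) (\<Union>i. A i)\<bar> < e)"
        unfolding top by blast
    qed
  qed
qed

section \<open>Comparison of the two topologies\<close>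

lemma openin_weak_topology_basic:
  fixes f :: "'a::topological_space \<Rightarrow> real"
  assumes "continuous_on UNIV f" "bounded (range f)" "open U"
  shows "openin weak_topology {P \<in> prob_measures. integral\<^sup>L P f \<in> U}"
  unfolding weak_topology_def using assms by (intro topology_generated_by_Basis) blast

text \<open>
  The functions \<open>min 1 (k * dist(x, -U))\<close> increase to the indicator of \<open>U\<close>. The case \<open>U = UNIV\<close> has to be
  excluded because \<open>infdist x {}\<close> is \<open>0\<close> by convention.
\<close>

lemma integral_open_eq_limit_continuous:
  fixes P :: "'a::metric_space measure"
  assumes P: "prob_space P" "sets P = sets borel" and U: "open U" "U \<noteq> UNIV"
  shows "(\<lambda>k. \<integral>x. min 1 (real k * infdist x (- U)) \<partial>P) \<longlonglongrightarrow> measure P U"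
proof -
  interpret prob_space P by fact
  have [measurable_cong]: "sets P = sets borel" by fact
  have [measurable]: "U \<in> sets borel" using U by simp
  have meas [measurable]: "(\<lambda>x. infdist x (- U)) \<in> borel_measurable borel"
    by (intro borel_measurable_continuous_onI continuous_intros)
  have "(\<lambda>k. \<integral>x. min 1 (real k * infdist x (- U)) \<partial>P) \<longlonglongrightarrow> (\<integral>x. indicator U x \<partial>P)"
  proof (rule integral_dominated_convergence[where w = "\<lambda>_. 1"])
    show "AE x in P. (\<lambda>k. min 1 (real k * infdist x (- U))) \<longlonglongrightarrow> indicator U x"
    proof (rule AE_I2)
      fix x
      show "(\<lambda>k. min 1 (real k * infdist x (- U))) \<longlonglongrightarrow> indicator U x"
      proof (cases "x \<in> U")
        case True
        then have pos: "infdist x (- U) > 0"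
          using U by (intro infdist_pos_not_in_closed) auto
        then obtain k0 where k0: "1 < real k0 * infdist x (- U)"
          using reals_Archimedean3 by blast
        have "1 \<le> real k * infdist x (- U)" if "k \<ge> k0" for k
        proof -
          have "real k0 * infdist x (- U) \<le> real k * infdist x (- U)"
            using that pos by (intro mult_right_mono) auto
          then show ?thesis using k0 by simp
        qed
        then have "\<forall>\<^sub>F k in sequentially. min 1 (real k * infdist x (- U)) = 1"
          by (intro eventually_sequentiallyI[of k0]) (simp add: min_def)
        then show ?thesis
          using True by (simp add: tendsto_eventually)
      qed simp
    qed
    show "AE x in P. norm (min 1 (real k * infdist x (- U))) \<le> 1" for k
      by (intro AE_I2) (simp add: min_def infdist_nonneg)
  qed auto
  then show ?thesis by simp
qed

lemma prob_measures_eqI_continuous: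
  fixes P Q :: "'a::metric_space measure"
  assumes P: "P \<in> prob_measures" and Q: "Q \<in> prob_measures"
    and eq: "\<And>f :: 'a \<Rightarrow> real. continuous_on UNIV f \<Longrightarrow> bounded (range f) \<Longrightarrow> integral\<^sup>L P f = integral\<^sup>L Q f"
  shows "P = Q"
proof (rule measure_eqI_generator_eq[where E = "{S. open S}" and \<Omega> = UNIV and A = "\<lambda>_. UNIV"])
  interpret P: prob_space P using P by (simp add: prob_measures_def)
  interpret Q: prob_space Q using Q by (simp add: prob_measures_def)
  have sets: "sets P = sets borel" "sets Q = sets borel"
    using P Q by (auto simp: prob_measures_def)
  then have space: "space P = UNIV" "space Q = UNIV"
    using sets_eq_imp_space_eq[OF sets(1)] sets_eq_imp_space_eq[OF sets(2)] by simp_all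
  show "sets P = sigma_sets UNIV {S. open S}" "sets Q = sigma_sets UNIV {S. open S}"
    using sets by (simp_all add: borel_def)
  show "Int_stable {S :: 'a set. open S}"
    by (auto simp: Int_stable_def)
  fix U :: "'a set" assume "U \<in> {S. open S}"
  then have U: "open U" by simp
  show "emeasure P U = emeasure Q U"
  proof (cases "U = UNIV")
    case True
    then show ?thesis
      using P.emeasure_space_1 Q.emeasure_space_1 space by simp
  next
    case False
    have "integral\<^sup>L P (\<lambda>x. min 1 (real k * infdist x (- U))) =
        integral\<^sup>L Q (\<lambda>x. min 1 (real k * infdist x (- U)))" for k
      by (intro eq continuous_intros boundedI[where B = 1]) (auto simp: min_def infdist_nonneg)
    then have "measure P U = measure Q U"
      using integral_open_eq_limit_continuous[OF P.prob_space_axioms sets(1) U False]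
        integral_open_eq_limit_continuous[OF Q.prob_space_axioms sets(2) U False]
      by (simp add: LIMSEQ_unique)
    then show ?thesis
      by (simp add: P.emeasure_eq_measure Q.emeasure_eq_measure)
  qed
qed (use P in \<open>auto simp: prob_measures_def prob_space_def finite_measure.emeasure_finite\<close>)

lemma Hausdorff_weak_topology: "Hausdorff_space (weak_topology :: 'a::metric_space measure topology)"
  unfolding Hausdorff_space_def topspace_weak_topology
proof (intro allI impI)
  fix P Q :: "'a measure"
  assume *: "P \<in> prob_measures \<and> Q \<in> prob_measures \<and> P \<noteq> Q"
  then obtain f :: "'a \<Rightarrow> real" where f: "continuous_on UNIV f" "bounded (range f)"
    and ne: "integral\<^sup>L P f \<noteq> integral\<^sup>L Q f"
    using prob_measures_eqI_continuous by metis
  obtain U V where UV: "open U" "open V" "integral\<^sup>L P f \<in> U" "integral\<^sup>L Q f \<in> V" "U \<inter> V = {}"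
    using hausdorff[OF ne] by blast
  have "disjnt {R \<in> prob_measures. integral\<^sup>L R f \<in> U} {R \<in> prob_measures. integral\<^sup>L R f \<in> V}"
    using UV by (auto simp: disjnt_def)
  then show "\<exists>U V. openin weak_topology U \<and> openin weak_topology V \<and> P \<in> U \<and> Q \<in> V \<and> disjnt U V"
    using UV * openin_weak_topology_basic[OF f UV(1)] openin_weak_topology_basic[OF f UV(2)]
    by (intro exI[of _ "{R \<in> prob_measures. integral\<^sup>L R f \<in> U}"]
      exI[of _ "{R \<in> prob_measures. integral\<^sup>L R f \<in> V}"]) simp
qed

text \<open>
  The weak topology is coarser than the \<open>\<tau>\<close>-topology, because \<open>P \<mapsto> \<integral> f dP\<close> is \<open>\<tau>\<close>-continuous for
  every bounded measurable \<open>f\<close>.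
\<close>

lemma continuous_map_tau_weak:
  "continuous_map tau_topology (weak_topology :: 'a::topological_space measure topology) id"
  unfolding weak_topology_def
proof (rule continuous_on_generated_topo)
  fix W :: "'a measure set"
  assume "W \<in> {{P \<in> prob_measures. integral\<^sup>L P f \<in> U} |f U.
      continuous_on UNIV (f :: 'a \<Rightarrow> real) \<and> bounded (range f) \<and> open U}"
  then obtain f U where W: "W = {P \<in> prob_measures. integral\<^sup>L P f \<in> U}"
    and f: "continuous_on UNIV (f :: 'a \<Rightarrow> real)" "bounded (range f)" and U: "open U" by blast
  obtain b where b: "\<And>x. \<bar>f x\<bar> \<le> b"
    using f(2) by (auto simp: bounded_iff)
  have "continuous_map tau_topology euclideanreal (\<lambda>P. integral\<^sup>L P f)"
    by (rule continuous_map_integral_bounded[where N = borel and b = b])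
      (auto simp: prob_measures_def b continuous_map_measure_tau intro!: borel_measurable_continuous_onI f)
  then have "openin tau_topology {P \<in> topspace tau_topology. integral\<^sup>L P f \<in> U}"
    using U by (intro openin_continuous_map_preimage) auto
  then show "openin tau_topology (id -` W \<inter> topspace tau_topology)"
    by (simp add: W vimage_def Int_def conj_commute)
next
  show "id ` topspace tau_topology \<subseteq> \<Union> {{P \<in> prob_measures. integral\<^sup>L P f \<in> U} |f U.
      continuous_on UNIV (f :: 'a \<Rightarrow> real) \<and> bounded (range f) \<and> open U}"
    using topspace_weak_topology[where 'a = 'a]
    unfolding weak_topology_def topology_generated_by_topspace by simp
qed

lemma weak_closure_subset_tau_closure:
  fixes \<Theta> :: "'a::metric_space measure set"
  assumes "\<Theta> \<subseteq> prob_measures" and "relatively_compact_in tau_topology \<Theta>"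
  shows "weak_topology closure_of \<Theta> \<subseteq> tau_topology closure_of \<Theta>"
proof (rule closure_of_minimal)
  show "\<Theta> \<subseteq> tau_topology closure_of \<Theta>"
    using assms(1) by (simp add: closure_of_subset)
  have "compactin weak_topology (id ` (tau_topology closure_of \<Theta>))"
    using assms(2) continuous_map_tau_weak image_compactin
    unfolding relatively_compact_in_def by blast
  then show "closedin weak_topology (tau_topology closure_of \<Theta>)"
    using compactin_imp_closedin[OF Hausdorff_weak_topology] by simp
qed

section \<open>Indistinguishability\<close>

lemma continuous_map_le_on_closure:
  fixes f :: "'b \<Rightarrow> real"
  assumes f: "continuous_map (subtopology X (X closure_of S)) euclideanreal f"
    and S: "S \<subseteq> topspace X" and le: "\<And>x. x \<in> S \<Longrightarrow> f x \<le> a" and x: "x \<in> X closure_of S"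
  shows "f x \<le> a"
proof -
  define T where "T = {x \<in> topspace (subtopology X (X closure_of S)). f x \<in> {..a}}"
  have "closedin (subtopology X (X closure_of S)) T"
    unfolding T_def using f by (intro closedin_continuous_map_preimage) auto
  then have "closedin X T"
    using closedin_trans_full closedin_closure_of by blast
  moreover have "S \<subseteq> T"
    using S le closure_of_subset[OF S] by (auto simp: T_def)
  ultimately have "X closure_of S \<subseteq> T"
    by (intro closure_of_minimal)
  then show ?thesis
    using x by (auto simp: T_def)
qed

text \<open>
  The expectation of a test is continuous on the compact \<open>\<tau>\<close>-closure of \<open>\<Theta>\<close>, so a bound that holds
  on \<open>\<Theta>\<close> persists at limit points. Applied to \<open>K\<close> and to \<open>1 - K\<close>, this bounds both kinds of error from
  below at a common limit point of the hypotheses.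
\<close>

lemma expectation_le_sup_on_tau_closure:
  fixes \<Theta> :: "'a::topological_space measure set" and K :: "(nat \<Rightarrow> 'a) \<Rightarrow> real"
  assumes \<Theta>: "\<Theta> \<subseteq> prob_measures" "relatively_compact_in tau_topology \<Theta>"
    and K: "is_test n K" and P: "P \<in> tau_topology closure_of \<Theta>"
  shows "(\<integral>\<^sup>+x. ennreal (K x) \<partial>PiM {1..n} (\<lambda>_. P)) \<le>
    (SUP P\<in>\<Theta>. \<integral>\<^sup>+x. ennreal (K x) \<partial>PiM {1..n} (\<lambda>_. P))" (is "?E P \<le> ?s")
proof -
  let ?N = "PiM {1..n} (\<lambda>_. borel :: 'a measure)"
  define C where "C = tau_topology closure_of \<Theta>"
  have C: "compactin tau_topology C"
    using \<Theta>(2) by (simp add: relatively_compact_in_def C_def)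
  have top: "topspace (subtopology tau_topology C) = C"
    using compactin_subset_topspace[OF C] by auto
  have \<Theta>C: "\<Theta> \<subseteq> C"
    using \<Theta>(1) by (simp add: C_def closure_of_subset)
  have CP: "prob_space (PiM {1..n} (\<lambda>_. P)) \<and> sets (PiM {1..n} (\<lambda>_. P)) = sets ?N" if "P \<in> C" for P
    using compactin_subset_topspace[OF C] that
    by (auto simp: prob_measures_def intro!: prob_space_PiM sets_PiM_cong)
  have K_meas: "K \<in> borel_measurable ?N" and K_bound: "\<And>x. x \<in> space ?N \<Longrightarrow> 0 \<le> K x \<and> K x \<le> 1"
    using K by (auto simp: is_test_def)
  define f where "f P = integral\<^sup>L (PiM {1..n} (\<lambda>_. P)) K" for P
  have cont: "continuous_map (subtopology tau_topology C) euclideanreal f"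
    unfolding f_def
  proof (rule continuous_map_integral_bounded[where N = ?N and b = 1])
    show "\<bar>K x\<bar> \<le> 1" if "x \<in> space ?N" for x
      using K_bound[OF that] by simp
  qed (use CP top K_meas C in \<open>auto intro!: continuous_map_power_measure\<close>)
  have E: "?E P = ennreal (f P)" if "P \<in> C" for P
  proof -
    interpret prob_space "PiM {1..n} (\<lambda>_. P)" using CP[OF that] by blast
    have sets: "sets (PiM {1..n} (\<lambda>_. P)) = sets ?N" using CP[OF that] by blast
    then have space: "space (PiM {1..n} (\<lambda>_. P)) = space ?N" by (rule sets_eq_imp_space_eq)
    have "K \<in> borel_measurable (PiM {1..n} (\<lambda>_. P))"
      using K_meas measurable_cong_sets[OF sets refl] by blast
    then have "integrable (PiM {1..n} (\<lambda>_. P)) K"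
      using K_bound by (intro integrable_const_bound[where B = 1] AE_I2) (auto simp: space simp del: One_nat_def)
    then show ?thesis
      unfolding f_def using K_bound by (intro nn_integral_eq_integral AE_I2) (auto simp: space simp del: One_nat_def)
  qed
  show ?thesis
  proof (cases "?s = \<top>")
    case False
    then obtain a where a: "a \<ge> 0" "?s = ennreal a"
      by (cases ?s) auto
    have "f Q \<le> a" if "Q \<in> \<Theta>" for Q
    proof -
      have "?E Q \<le> ?s"
        using that by (rule SUP_upper)
      also have "?E Q = ennreal (f Q)"
        using that \<Theta>C by (intro E) blast
      finally show ?thesis
        using a by (simp only: ennreal_le_iff)
    qed
    then have "f P \<le> a"
      using continuous_map_le_on_closure[OF cont[unfolded C_def] _ _ P] \<Theta>(1) by simp
    moreover have "?E P = ennreal (f P)"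
      using P by (intro E) (simp add: C_def)
    ultimately show ?thesis
      using a by (simp only: ennreal_leI)
  next
    case True
    show ?thesis unfolding True by (rule top_greatest)
  qed
qed

lemma is_test_complement: "is_test n K \<Longrightarrow> is_test n (\<lambda>x. 1 - K x)"
  by (auto simp: is_test_def)

theorem tau_compact_indistinguishable:
  fixes \<Theta>0 \<Theta>1 :: "'a::metric_space measure set"
  assumes \<Theta>: "\<Theta>0 \<subseteq> prob_measures" "\<Theta>1 \<subseteq> prob_measures"
    and compact: "relatively_compact_in tau_topology \<Theta>0" "relatively_compact_in tau_topology \<Theta>1"
    and meet: "weak_topology closure_of \<Theta>0 \<inter> weak_topology closure_of \<Theta>1 \<noteq> {}"
  shows "indistinguishable \<Theta>0 \<Theta>1"
  unfolding indistinguishable_def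
proof (intro allI impI)
  fix n and K :: "(nat \<Rightarrow> 'a) \<Rightarrow> real"
  assume K: "is_test n K"
  obtain P where P: "P \<in> tau_topology closure_of \<Theta>0" "P \<in> tau_topology closure_of \<Theta>1"
    using meet weak_closure_subset_tau_closure[OF \<Theta>(1) compact(1)]
      weak_closure_subset_tau_closure[OF \<Theta>(2) compact(2)] by blast
  have P_prob: "prob_space P" "sets P = sets borel"
    using closure_of_subset_topspace[of tau_topology \<Theta>0] P(1) by (auto simp: prob_measures_def)
  let ?Pn = "PiM {1..n} (\<lambda>_. P)"
  interpret prob_space ?Pn
    using P_prob by (intro prob_space_PiM) auto
  have sets: "sets ?Pn = sets (PiM {1..n} (\<lambda>_. borel))"
    using P_prob by (intro sets_PiM_cong) auto
  then have space: "space ?Pn = space (PiM {1..n} (\<lambda>_. borel))" by (rule sets_eq_imp_space_eq)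
  have [measurable]: "K \<in> borel_measurable ?Pn"
    using K measurable_cong_sets[OF sets refl] by (auto simp: is_test_def)
  have "1 = (\<integral>\<^sup>+x. 1 \<partial>?Pn)"
    using emeasure_space_1 by (simp del: One_nat_def)
  also have "\<dots> = (\<integral>\<^sup>+x. ennreal (K x) + ennreal (1 - K x) \<partial>?Pn)"
    using K by (intro nn_integral_cong) (auto simp: is_test_def space simp flip: ennreal_plus simp del: One_nat_def)
  also have "\<dots> = (\<integral>\<^sup>+x. ennreal (K x) \<partial>?Pn) + (\<integral>\<^sup>+x. ennreal (1 - K x) \<partial>?Pn)"
    by (rule nn_integral_add) measurable
  also have "\<dots> \<le> type1_error \<Theta>0 n K + type2_error \<Theta>1 n K"
    unfolding type1_error_def type2_error_def
    using expectation_le_sup_on_tau_closure[OF \<Theta>(1) compact(1) K P(1)]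
      expectation_le_sup_on_tau_closure[OF \<Theta>(2) compact(2) is_test_complement[OF K] P(2)]
    by (rule add_mono)
  finally show "type1_error \<Theta>0 n K + type2_error \<Theta>1 n K \<ge> 1" .
qed

section \<open>Separation by finitely many bounded continuous functions\<close>

lemma openin_weak_topology_finite:
  fixes G :: "('a::topological_space \<Rightarrow> real) set"
  assumes "finite G" and "\<And>g. g \<in> G \<Longrightarrow> continuous_on UNIV g \<and> bounded (range g)"
  shows "openin weak_topology {Q \<in> prob_measures. \<forall>g\<in>G. \<bar>integral\<^sup>L Q g\<bar> < r}"
  using assms
proof (induction G rule: finite_induct)
  case empty
  then show ?case
    using openin_topspace[of "weak_topology :: 'a measure topology"] by simp
next
  case (insert g G)
  have "openin weak_topology {Q \<in> prob_measures. integral\<^sup>L Q g \<in> {-r<..<r}}"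
    using insert.prems by (intro openin_weak_topology_basic) auto
  then have "openin weak_topology ({Q \<in> prob_measures. integral\<^sup>L Q g \<in> {-r<..<r}} \<inter>
      {Q \<in> prob_measures. \<forall>g\<in>G. \<bar>integral\<^sup>L Q g\<bar> < r})"
    using insert by (intro openin_Int) auto
  also have "{Q \<in> prob_measures. integral\<^sup>L Q g \<in> {-r<..<r}} \<inter>
      {Q \<in> prob_measures. \<forall>g\<in>G. \<bar>integral\<^sup>L Q g\<bar> < r} =
      {Q \<in> prob_measures. \<forall>g\<in>insert g G. \<bar>integral\<^sup>L Q g\<bar> < r}"
    by auto
  finally show ?case .
qed

lemma integrable_continuous_bounded:
  fixes f :: "'a::topological_space \<Rightarrow> real"
  assumes P: "P \<in> prob_measures" and f: "continuous_on UNIV f" "bounded (range f)"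
  shows "integrable P f"
proof -
  interpret prob_space P using P by (simp add: prob_measures_def)
  have [measurable_cong]: "sets P = sets borel" using P by (simp add: prob_measures_def)
  have [measurable]: "f \<in> borel_measurable borel"
    using f by (intro borel_measurable_continuous_onI)
  obtain b where "\<And>x. \<bar>f x\<bar> \<le> b"
    using f(2) by (auto simp: bounded_iff)
  then show ?thesis
    by (intro integrable_const_bound[where B = b]) auto
qed

text \<open>
  Centring the functions at \<open>P\<close> and rescaling them lets the radii \<open>1\<close> and \<open>2\<close> serve for every
  neighbourhood. The gap between the two radii is what a test can detect.
\<close>

lemma weak_neighbourhood_functionals:
  fixes W :: "'a::topological_space measure set"
  assumes W: "openin weak_topology W" and P: "P \<in> prob_measures" and PW: "P \<in> W"
  shows "\<exists>G. finite G \<and> (\<forall>g\<in>G. continuous_on UNIV g \<and> bounded (range g) \<and> \<bar>integral\<^sup>L P g\<bar> < 1) \<and>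
    {Q \<in> prob_measures. \<forall>g\<in>G. \<bar>integral\<^sup>L Q (g :: 'a \<Rightarrow> real)\<bar> < 2} \<subseteq> W"
proof -
  define \<B> where "\<B> = {{P \<in> prob_measures. integral\<^sup>L P f \<in> U} | (f :: 'a \<Rightarrow> real) U.
        continuous_on UNIV f \<and> bounded (range f) \<and> open U}"
  define nbhd where "nbhd G A \<longleftrightarrow> finite G \<and>
      (\<forall>g\<in>G. continuous_on UNIV g \<and> bounded (range g) \<and> \<bar>integral\<^sup>L P g\<bar> < 1) \<and>
      {Q \<in> prob_measures. \<forall>g\<in>G. \<bar>integral\<^sup>L Q g\<bar> < 2} \<subseteq> A"
    for G :: "('a \<Rightarrow> real) set" and A
  have "generate_topology_on \<B> W"
    using W unfolding weak_topology_def \<B>_def by (rule openin_topology_generated_by)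
  then have "\<exists>G. nbhd G W" using PW
  proof (induction rule: generate_topology_on.induct)
    case (Int A B)
    obtain G H where "nbhd G A" "nbhd H B"
      using Int.IH Int.prems by (metis IntD1 IntD2)
    then have "nbhd (G \<union> H) (A \<inter> B)"
      unfolding nbhd_def by (auto simp: ball_Un)
    then show ?case ..
  next
    case (UN K)
    obtain A where A: "A \<in> K" "P \<in> A"
      using UN.prems by (rule UnionE)
    obtain G where "nbhd G A"
      using UN.IH[OF A] by (rule exE)
    then have "nbhd G (\<Union>K)"
      unfolding nbhd_def using Union_upper[OF A(1)] by (meson order_trans)
    then show ?case ..
  next
    case (Basis S)
    then obtain f :: "'a \<Rightarrow> real" and U where S: "S = {P \<in> prob_measures. integral\<^sup>L P f \<in> U}"
      and f: "continuous_on UNIV f" "bounded (range f)" and U: "open U"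
      unfolding \<B>_def by blast
    define p where "p = integral\<^sup>L P f"
    have "p \<in> U" using Basis.prems by (simp add: S p_def)
    then obtain e where e: "e > 0" "ball p e \<subseteq> U"
      using U open_contains_ball by blast
    \<comment> \<open>With this scaling, radius \<open>2\<close> for \<open>g\<close> is radius \<open>e\<close> for \<open>f\<close>.\<close>
    define g where "g x = (2 / e) * (f x - p)" for x
    have g: "integral\<^sup>L Q g = (2 / e) * (integral\<^sup>L Q f - p)" if Q: "Q \<in> prob_measures" for Q
    proof -
      interpret prob_space Q using Q by (simp add: prob_measures_def)
      show ?thesis
        using integrable_continuous_bounded[OF Q f] unfolding g_def by (simp add: prob_space)
    qed
    have "continuous_on UNIV g"
      unfolding g_def using f by (intro continuous_intros)
    moreover have "bounded (range g)"
    proof -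
      have "range g = (\<lambda>y. (2 / e) *\<^sub>R y) ` ((\<lambda>x. - p + x) ` range f)"
        unfolding g_def by (auto simp: image_image)
      show ?thesis
        unfolding \<open>range g = _\<close> by (intro bounded_scaling bounded_translation f)
    qed
    moreover have "\<bar>integral\<^sup>L P g\<bar> < 1"
      using g[OF P] by (simp add: p_def)
    moreover have "{Q \<in> prob_measures. \<forall>h\<in>{g}. \<bar>integral\<^sup>L Q h\<bar> < 2} \<subseteq> S"
    proof
      fix Q assume "Q \<in> {Q \<in> prob_measures. \<forall>h\<in>{g}. \<bar>integral\<^sup>L Q h\<bar> < 2}"
      then have Q: "Q \<in> prob_measures" "\<bar>integral\<^sup>L Q g\<bar> < 2" by auto
      then have "\<bar>integral\<^sup>L Q f - p\<bar> < e"
        using e(1) by (simp add: g abs_mult field_simps)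
      then have "integral\<^sup>L Q f \<in> ball p e"
        by (simp add: dist_real_def abs_minus_commute)
      then show "Q \<in> S"
        using Q e(2) by (auto simp: S)
    qed
    ultimately have "nbhd {g} S"
      unfolding nbhd_def by simp
    then show ?case ..
  qed simp
  then show ?thesis
    unfolding nbhd_def .
qed

text \<open>
  Each law in the weak closure of \<open>\<Theta>0\<close> has a neighbourhood of radius \<open>2\<close> that misses \<open>\<Theta>1\<close>; finitely many
  of the corresponding neighbourhoods of radius \<open>1\<close> cover \<open>\<Theta>0\<close>. Each element of \<open>\<G>\<close> describes one of
  these neighbourhoods.
\<close>

lemma compact_weak_separation:
  fixes \<Theta>0 \<Theta>1 :: "'a::topological_space measure set"
  assumes \<Theta>: "\<Theta>0 \<subseteq> prob_measures" "\<Theta>1 \<subseteq> prob_measures"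
    and compact: "relatively_compact_in weak_topology \<Theta>0"
    and disj: "weak_topology closure_of \<Theta>0 \<inter> weak_topology closure_of \<Theta>1 = {}"
  obtains \<G> :: "('a \<Rightarrow> real) set set" where "finite \<G>"
    and "\<And>G. G \<in> \<G> \<Longrightarrow> finite G"
    and "\<And>G g. G \<in> \<G> \<Longrightarrow> g \<in> G \<Longrightarrow> continuous_on UNIV g \<and> bounded (range g)"
    and "\<And>Q. Q \<in> \<Theta>0 \<Longrightarrow> \<exists>G\<in>\<G>. \<forall>g\<in>G. \<bar>integral\<^sup>L Q g\<bar> < 1"
    and "\<And>Q. Q \<in> \<Theta>1 \<Longrightarrow> \<forall>G\<in>\<G>. \<exists>g\<in>G. 2 \<le> \<bar>integral\<^sup>L Q g\<bar>"
proof -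
  define C where "C = weak_topology closure_of \<Theta>0"
  define W where "W = topspace weak_topology - weak_topology closure_of \<Theta>1"
  have W: "openin weak_topology W"
    unfolding W_def by (intro openin_diff openin_topspace closedin_closure_of)
  have C: "compactin weak_topology C"
    using compact by (simp add: C_def relatively_compact_in_def)
  have C_prob: "C \<subseteq> prob_measures"
    using compactin_subset_topspace[OF C] by simp
  have CW: "C \<subseteq> W"
    using disj C_prob by (auto simp: C_def W_def)
  have "\<forall>P\<in>C. \<exists>G. finite G \<and> (\<forall>g\<in>G. continuous_on UNIV g \<and> bounded (range g) \<and> \<bar>integral\<^sup>L P g\<bar> < 1) \<and>
    {Q \<in> prob_measures. \<forall>g\<in>G. \<bar>integral\<^sup>L Q (g :: 'a \<Rightarrow> real)\<bar> < 2} \<subseteq> W"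
    using C_prob CW by (intro ballI weak_neighbourhood_functionals[OF W]) auto
  from bchoice[OF this] obtain G where *: "\<forall>P\<in>C. finite (G P) \<and>
      (\<forall>g\<in>G P. continuous_on UNIV g \<and> bounded (range g) \<and> \<bar>integral\<^sup>L P g\<bar> < 1) \<and>
      {Q \<in> prob_measures. \<forall>g\<in>G P. \<bar>integral\<^sup>L Q (g :: 'a \<Rightarrow> real)\<bar> < 2} \<subseteq> W"
    by (rule exE)
  have G: "finite (G P)"
    "\<And>g. g \<in> G P \<Longrightarrow> continuous_on UNIV g \<and> bounded (range g)"
    "\<And>g. g \<in> G P \<Longrightarrow> \<bar>integral\<^sup>L P g\<bar> < 1"
    "{Q \<in> prob_measures. \<forall>g\<in>G P. \<bar>integral\<^sup>L Q (g :: 'a \<Rightarrow> real)\<bar> < 2} \<subseteq> W"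
    if "P \<in> C" for P
    using bspec[OF * that] by simp_all
  define V where "V P = {Q \<in> prob_measures. \<forall>g\<in>G P. \<bar>integral\<^sup>L Q g\<bar> < 1}" for P
  have "openin weak_topology U" if "U \<in> V ` C" for U
    using that G(1,2) unfolding V_def by (auto intro!: openin_weak_topology_finite)
  moreover have "C \<subseteq> \<Union>(V ` C)"
    using C_prob G(3) by (auto simp: V_def)
  ultimately obtain F where F: "finite F" "F \<subseteq> V ` C" "C \<subseteq> \<Union>F"
    using compactinD[OF C, of "V ` C"] by metis
  then obtain J where J: "J \<subseteq> C" "finite J" "F = V ` J"
    by (meson finite_subset_image)
  show thesis
  proof (rule that[of "G ` J"])
    show "\<exists>H\<in>G ` J. \<forall>g\<in>H. \<bar>integral\<^sup>L Q g\<bar> < 1" if "Q \<in> \<Theta>0" for Q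
    proof -
      have "Q \<in> C"
        using that closure_of_subset[of \<Theta>0 weak_topology] \<Theta>(1) by (auto simp: C_def)
      then obtain P where "P \<in> J" "Q \<in> V P"
        using F(3) J(3) by blast
      then show ?thesis by (auto simp: V_def)
    qed
    show "\<forall>H\<in>G ` J. \<exists>g\<in>H. 2 \<le> \<bar>integral\<^sup>L Q g\<bar>" if Q: "Q \<in> \<Theta>1" for Q
    proof (intro ballI, rule ccontr)
      fix H assume H: "H \<in> G ` J" and no: "\<not> (\<exists>g\<in>H. 2 \<le> \<bar>integral\<^sup>L Q g\<bar>)"
      obtain P where P: "P \<in> J" "H = G P" using H by blast
      have "Q \<in> {Q \<in> prob_measures. \<forall>g\<in>G P. \<bar>integral\<^sup>L Q g\<bar> < 2}"
        using Q \<Theta>(2) no P(2) by (auto simp: not_le)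
      then have "Q \<in> W"
        using G(4)[of P] P J(1) by blast
      moreover have "Q \<in> weak_topology closure_of \<Theta>1"
        using Q closure_of_subset[of \<Theta>1 weak_topology] \<Theta>(2) by auto
      ultimately show False by (simp add: W_def)
    qed
  qed (use J G in auto)
qed

section \<open>Exponentially consistent tests\<close>

text \<open>
  Hoeffding's inequality for the coordinates of the product measure, with range of length \<open>2 * B\<close>. It is
  uniform in \<open>P\<close>, since the bound involves only \<open>B\<close>, \<open>\<epsilon>\<close> and the sample size.
\<close>

lemma empirical_sum_tail:
  fixes P :: "'a::topological_space measure" and g :: "'a \<Rightarrow> real" and I :: "'i set" and \<epsilon> :: real
  assumes law: "prob_space P" "sets P = sets borel" and g: "g \<in> borel_measurable borel"
    and bound: "\<And>x. \<bar>g x\<bar> \<le> B" and B: "B > 0" and I: "finite I" "I \<noteq> {}" and \<epsilon>: "\<epsilon> \<ge> 0"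
  shows "measure (PiM I (\<lambda>_. P))
      {x \<in> space (PiM I (\<lambda>_. P)). \<bar>(\<Sum>i\<in>I. g (x i)) - card I * integral\<^sup>L P g\<bar> \<ge> card I * \<epsilon>}
    \<le> 2 * exp (- \<epsilon>\<^sup>2 / (2 * B\<^sup>2) * card I)"
proof -
  interpret single: prob_space P by (rule law(1))
  interpret product_prob_space "\<lambda>_. P" I by unfold_locales
  let ?Pn = "PiM I (\<lambda>_. P)"
  have gP [measurable]: "g \<in> borel_measurable P"
    using g measurable_cong_sets[OF law(2) refl] by blast
  have "P.indep_vars (\<lambda>_. P) (\<lambda>i x. x i) I"
  proof (subst P.indep_vars_iff_distr_eq_PiM')
    have "distr ?Pn ?Pn (\<lambda>x. \<lambda>i\<in>I. x i) = distr ?Pn ?Pn (\<lambda>x. x)"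
      by (intro distr_cong) (auto simp: space_PiM PiE_def extensional_restrict)
    also have "\<dots> = ?Pn" by simp
    also have "\<dots> = PiM I (\<lambda>i. distr ?Pn P (\<lambda>x. x i))"
      by (intro PiM_cong) (simp_all add: PiM_component)
    finally show "distr ?Pn ?Pn (\<lambda>x. \<lambda>i\<in>I. x i) = PiM I (\<lambda>i. distr ?Pn P (\<lambda>x. x i))" .
  qed (use I in auto)
  then have indep: "P.indep_vars (\<lambda>_. borel) (\<lambda>i x. g (x i)) I"
    by (rule P.indep_vars_compose2) simp
  have expect: "P.expectation (\<lambda>x. g (x i)) = integral\<^sup>L P g" if i: "i \<in> I" for i
  proof -
    have "integral\<^sup>L P g = integral\<^sup>L (distr ?Pn P (\<lambda>x. x i)) g"
      using i by (simp add: PiM_component)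
    also have "\<dots> = P.expectation (\<lambda>x. g (x i))"
      using i by (intro integral_distr) auto
    finally show ?thesis by simp
  qed
  interpret H: Hoeffding_ineq ?Pn I "\<lambda>i x. g (x i)" "\<lambda>_. - B" "\<lambda>_. B" "card I * integral\<^sup>L P g"
  proof unfold_locales
    show "AE x in ?Pn. g (x i) \<in> {- B..B}" for i
      using bound by (intro AE_I2) (auto simp: abs_le_iff minus_le_iff)
  qed (use I indep expect in auto)
  have card: "card I > 0" using I by (simp add: card_gt_0_iff)
  have "P.prob {x \<in> space ?Pn. \<bar>(\<Sum>i\<in>I. g (x i)) - card I * integral\<^sup>L P g\<bar> \<ge> card I * \<epsilon>}
      \<le> 2 * exp (- 2 * (card I * \<epsilon>)\<^sup>2 / (\<Sum>i\<in>I. (B - - B)\<^sup>2))"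
    using \<epsilon> B card by (intro H.Hoeffding_ineq_abs_ge) auto
  also have "- 2 * (card I * \<epsilon>)\<^sup>2 / (\<Sum>i\<in>I. (B - - B)\<^sup>2) = - \<epsilon>\<^sup>2 / (2 * B\<^sup>2) * card I"
    using B card by (simp add: field_simps power2_eq_square)
  finally show ?thesis .
qed

definition exponentially_distinguishable ::
    "'a::topological_space measure set \<Rightarrow> 'a measure set \<Rightarrow> bool" where
  "exponentially_distinguishable \<Theta>0 \<Theta>1 \<longleftrightarrow>
     (\<exists>(K :: nat \<Rightarrow> (nat \<Rightarrow> 'a) \<Rightarrow> real) (c::real) (n\<^sub>0::nat).
        (\<forall>n\<ge>1. is_test n (K n)) \<and> c > 0 \<and>
        (\<forall>n>n\<^sub>0. type1_error \<Theta>0 n (K n) \<le> ennreal (exp (- c * real n)) \<and>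
                type2_error \<Theta>1 n (K n) \<le> ennreal (exp (- c * real n))))"

lemma exponentially_distinguishable_sym:
  assumes "exponentially_distinguishable \<Theta>0 \<Theta>1"
  shows "exponentially_distinguishable \<Theta>1 \<Theta>0"
proof -
  obtain K :: "nat \<Rightarrow> (nat \<Rightarrow> 'a) \<Rightarrow> real" and c :: real and n0 where K: "\<And>n. n \<ge> 1 \<Longrightarrow> is_test n (K n)" "c > 0"
    "\<And>n. n > n0 \<Longrightarrow> type1_error \<Theta>0 n (K n) \<le> ennreal (exp (- c * real n))"
    "\<And>n. n > n0 \<Longrightarrow> type2_error \<Theta>1 n (K n) \<le> ennreal (exp (- c * real n))"
    using assms unfolding exponentially_distinguishable_def by blast
  have "type1_error \<Theta>1 n (\<lambda>x. 1 - K n x) = type2_error \<Theta>1 n (K n)"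
    and "type2_error \<Theta>0 n (\<lambda>x. 1 - K n x) = type1_error \<Theta>0 n (K n)" for n
    by (simp_all add: type1_error_def type2_error_def)
  then show ?thesis
    unfolding exponentially_distinguishable_def using K
    by (intro exI[of _ "\<lambda>n x. 1 - K n x"] exI[of _ c] exI[of _ n0]) (auto intro: is_test_complement)
qed

text \<open>
  For the finitely many sample sizes at which the exponential bound does not yet fall below the
  required level, the test that never rejects keeps the error of the first kind at \<open>0\<close>.
\<close>

lemma exponentially_distinguishable_imp_distinguishable:
  fixes \<Theta>0 \<Theta>1 :: "'a::topological_space measure set"
  assumes "exponentially_distinguishable \<Theta>0 \<Theta>1"
  shows "distinguishable \<Theta>0 \<Theta>1"
  unfolding distinguishable_def
proof (intro allI impI)
  fix a :: real assume a: "0 < a \<and> a < 1"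
  obtain K :: "nat \<Rightarrow> (nat \<Rightarrow> 'a) \<Rightarrow> real" and c :: real and n0 where K: "\<And>n. n \<ge> 1 \<Longrightarrow> is_test n (K n)" "c > 0"
    "\<And>n. n > n0 \<Longrightarrow> type1_error \<Theta>0 n (K n) \<le> ennreal (exp (- c * real n))"
    "\<And>n. n > n0 \<Longrightarrow> type2_error \<Theta>1 n (K n) \<le> ennreal (exp (- c * real n))"
    using assms unfolding exponentially_distinguishable_def by blast
  have lim: "(\<lambda>n. exp (- c * real n)) \<longlonglongrightarrow> 0"
    using K(2) by real_asymp
  then have "\<forall>\<^sub>F n in sequentially. exp (- c * real n) < a"
    using a by (intro order_tendstoD) auto
  then obtain N where N: "\<And>n. n \<ge> N \<Longrightarrow> exp (- c * real n) < a"
    by (auto simp: eventually_sequentially)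
  define L where "L n = (if n > max N n0 then K n else (\<lambda>_. 0))" for n
  have "is_test n (L n) \<and> type1_error \<Theta>0 n (L n) < ennreal a" if "n \<ge> 1" for n
  proof (cases "n > max N n0")
    case True
    have "type1_error \<Theta>0 n (K n) \<le> ennreal (exp (- c * real n))"
      using True K(3) by simp
    also have "\<dots> < ennreal a"
      using N[of n] True a by (intro ennreal_lessI) auto
    finally show ?thesis
      using True K(1)[OF that] by (simp add: L_def)
  next
    case False
    have "type1_error \<Theta>0 n (\<lambda>_. 0) \<le> 0"
      unfolding type1_error_def by (intro SUP_least) simp
    moreover have "L n = (\<lambda>_. 0)"
      unfolding L_def using False by (rule if_not_P)
    ultimately show ?thesis
      using a by (simp add: is_test_def)
  qed
  moreover have "(\<lambda>n. type2_error \<Theta>1 n (L n)) \<longlonglongrightarrow> 0"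
  proof (rule tendsto_sandwich[where f = "\<lambda>_. 0"])
    show "\<forall>\<^sub>F n in sequentially. type2_error \<Theta>1 n (L n) \<le> ennreal (exp (- c * real n))"
      by (intro eventually_sequentiallyI[of "Suc (max N n0)"]) (use K(4) in \<open>auto simp: L_def\<close>)
    show "(\<lambda>n. ennreal (exp (- c * real n))) \<longlonglongrightarrow> 0"
      using tendsto_ennrealI[OF lim] by simp
  qed auto
  ultimately show "\<exists>K. (\<forall>n\<ge>1. is_test n (K n) \<and> type1_error \<Theta>0 n (K n) < ennreal a) \<and>
      (\<lambda>n. type2_error \<Theta>1 n (K n)) \<longlonglongrightarrow> 0"
    by blast
qed

text \<open>
  The test accepts if for some \<open>G \<in> \<G>\<close> all empirical means over \<open>G\<close> are below \<open>3/2\<close> in absolute value. Under \<open>\<Theta>0\<close>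
  some \<open>G\<close> has all expectations below \<open>1\<close>, under \<open>\<Theta>1\<close> every \<open>G\<close> has an expectation of at least \<open>2\<close>, so a
  wrong decision forces some empirical mean to deviate by at least \<open>1/2\<close>.
\<close>

lemma weak_compact_exponentially_distinguishable:
  fixes \<Theta>0 \<Theta>1 :: "'a::topological_space measure set"
  assumes \<Theta>: "\<Theta>0 \<subseteq> prob_measures" "\<Theta>1 \<subseteq> prob_measures"
    and compact: "relatively_compact_in weak_topology \<Theta>0"
    and disj: "weak_topology closure_of \<Theta>0 \<inter> weak_topology closure_of \<Theta>1 = {}"
  shows "exponentially_distinguishable \<Theta>0 \<Theta>1"
proof -
  obtain \<G> :: "('a \<Rightarrow> real) set set" where fin: "finite \<G>" "\<And>G. G \<in> \<G> \<Longrightarrow> finite G"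
    and cont: "\<And>G g. G \<in> \<G> \<Longrightarrow> g \<in> G \<Longrightarrow> continuous_on UNIV g \<and> bounded (range g)"
    and sep0: "\<And>Q. Q \<in> \<Theta>0 \<Longrightarrow> \<exists>G\<in>\<G>. \<forall>g\<in>G. \<bar>integral\<^sup>L Q g\<bar> < 1"
    and sep1: "\<And>Q. Q \<in> \<Theta>1 \<Longrightarrow> \<forall>G\<in>\<G>. \<exists>g\<in>G. 2 \<le> \<bar>integral\<^sup>L Q g\<bar>"
    using compact_weak_separation[OF \<Theta> compact disj] by blast
  define F where "F = \<Union>\<G>"
  have F: "finite F" using fin by (auto simp: F_def)
  have F_meas [measurable]: "g \<in> borel_measurable borel" if "g \<in> F" for g
    using that cont by (auto simp: F_def intro!: borel_measurable_continuous_onI)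
  have "bounded (\<Union>g\<in>F. range g)"
    using F cont by (intro bounded_UN) (auto simp: F_def)
  then obtain B where B: "B > 0" "\<And>g x. g \<in> F \<Longrightarrow> \<bar>g x\<bar> \<le> B"
    by (auto simp: bounded_pos)
  \<comment> \<open>Hoeffding's bound for a deviation of \<open>1/2\<close> has rate \<open>1 / (8 * B\<^sup>2) = 2 * c\<close>; the other half of the
    rate absorbs the factor \<open>2 * card F\<close> of the union bound.\<close>
  define c where "c = 1 / (16 * B\<^sup>2)"
  have c: "c > 0" using B by (simp add: c_def)
  \<comment> \<open>Both kinds of error are contained in the event \<open>dev n P\<close> that some empirical mean is off by \<open>1/2\<close>.\<close>
  define dev where "dev n P = (\<Union>g\<in>F. {x \<in> space (PiM {1..n} (\<lambda>_. P)).
      \<bar>(\<Sum>i\<in>{1..n}. g (x i)) - card {1..n} * integral\<^sup>L P g\<bar> \<ge> card {1..n} * (1 / 2)})"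
    for n :: nat and P :: "'a measure"
  define R where "R n = {x \<in> space (PiM {1..n} (\<lambda>_. borel :: 'a measure)).
      \<forall>G\<in>\<G>. \<exists>g\<in>G. \<bar>\<Sum>i\<in>{1..n}. g (x i)\<bar> \<ge> 3 / 2 * real n}" for n :: nat
  have R_sets: "R n \<in> sets (PiM {1..n} (\<lambda>_. borel))" for n
    unfolding R_def
  proof (intro sets.sets_Collect_finite_All sets.sets_Collect_finite_Ex fin)
    fix G g assume "G \<in> \<G>" "g \<in> G"
    then have [measurable]: "g \<in> borel_measurable borel"
      by (intro F_meas) (auto simp: F_def)
    show "{x \<in> space (PiM {1..n} (\<lambda>_. borel)). \<bar>\<Sum>i\<in>{1..n}. g (x i)\<bar> \<ge> 3 / 2 * real n}
        \<in> sets (PiM {1..n} (\<lambda>_. borel))"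
      by measurable
  qed
  define K where "K n = (indicator (R n) :: _ \<Rightarrow> real)" for n
  have K_test: "is_test n (K n)" for n
    using R_sets[of n] by (auto simp: is_test_def K_def indicator_def)
  \<comment> \<open>Beyond \<open>n0\<close> one has \<open>2 * card F \<le> c * n \<le> exp (c * n)\<close>.\<close>
  define n0 where "n0 = nat \<lceil>2 * real (card F) / c\<rceil>"
  have rate: "2 * real (card F) * exp (- 2 * c * real n) \<le> exp (- c * real n)" if "n > n0" for n
  proof -
    have "2 * real (card F) / c \<le> real n"
      using that unfolding n0_def by linarith
    then have "2 * real (card F) \<le> 1 + c * real n"
      using c by (simp add: field_simps)
    also have "\<dots> \<le> exp (c * real n)"
      by (rule exp_ge_add_one_self)
    finally have "2 * real (card F) * exp (- 2 * c * real n) \<le> exp (c * real n) * exp (- 2 * c * real n)"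
      by (rule mult_right_mono) simp
    also have "\<dots> = exp (- c * real n)"
      by (simp flip: exp_add)
    finally show ?thesis .
  qed
  have small: "emeasure (PiM {1..n} (\<lambda>_. P)) A \<le> ennreal (exp (- c * real n))"
    if P: "P \<in> prob_measures" and n: "n > n0" and A: "A \<subseteq> dev n P" for P n A
  proof -
    interpret prob_space P using P by (simp add: prob_measures_def)
    interpret Pn: prob_space "PiM {1..n} (\<lambda>_. P)" by (intro prob_space_PiM) unfold_locales
    have sets: "sets P = sets borel" using P by (simp add: prob_measures_def)
    then have [measurable_cong]: "sets P = sets borel" .
    define D where "D g = {x \<in> space (PiM {1..n} (\<lambda>_. P)).
      \<bar>(\<Sum>i\<in>{1..n}. g (x i)) - card {1..n} * integral\<^sup>L P g\<bar> \<ge> card {1..n} * (1 / 2)}" for g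
    have D_sets: "D g \<in> sets (PiM {1..n} (\<lambda>_. P))" if "g \<in> F" for g
    proof -
      have [measurable]: "g \<in> borel_measurable borel" using that by (rule F_meas)
      show ?thesis unfolding D_def by measurable
    qed
    have dev: "dev n P = (\<Union>g\<in>F. D g)" by (simp add: dev_def D_def)
    have "measure (PiM {1..n} (\<lambda>_. P)) (\<Union>g\<in>F. D g) \<le> (\<Sum>g\<in>F. measure (PiM {1..n} (\<lambda>_. P)) (D g))"
      using F D_sets by (intro Pn.finite_measure_subadditive_finite) auto
    also have "\<dots> \<le> (\<Sum>g\<in>F. 2 * exp (- 2 * c * real n))"
    proof (rule sum_mono)
      fix g assume g: "g \<in> F"
      have "measure (PiM {1..n} (\<lambda>_. P)) (D g) \<le>
          2 * exp (- (1 / 2)\<^sup>2 / (2 * B\<^sup>2) * card {1..n})"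
        unfolding D_def
        by (rule empirical_sum_tail) (use n B g F_meas sets prob_space_axioms in auto)
      also have "- (1 / 2)\<^sup>2 / (2 * B\<^sup>2) * real (card {1..n}) = - 2 * c * real n"
        by (simp add: c_def field_simps)
      finally show "measure (PiM {1..n} (\<lambda>_. P)) (D g) \<le> 2 * exp (- 2 * c * real n)" .
    qed
    also have "\<dots> \<le> exp (- c * real n)"
      using rate[OF n] by simp
    finally have "ennreal (measure (PiM {1..n} (\<lambda>_. P)) (dev n P)) \<le> ennreal (exp (- c * real n))"
      unfolding dev by (rule ennreal_leI)
    moreover have "emeasure (PiM {1..n} (\<lambda>_. P)) A \<le> emeasure (PiM {1..n} (\<lambda>_. P)) (dev n P)"
      using A D_sets F unfolding dev by (intro emeasure_mono) auto
    ultimately show ?thesis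
      by (simp only: Pn.emeasure_eq_measure)
  qed
  have sp: "space (PiM {1..n} (\<lambda>_. P)) = space (PiM {1..n} (\<lambda>_. borel))"
    and st: "sets (PiM {1..n} (\<lambda>_. P)) = sets (PiM {1..n} (\<lambda>_. borel))"
    if "P \<in> prob_measures" for P :: "'a measure" and n
    using that sets_PiM_cong[of "{1..n}" "{1..n}" "\<lambda>_. P" "\<lambda>_. borel"]
    by (auto simp: prob_measures_def intro!: sets_eq_imp_space_eq simp del: One_nat_def)
  have "type1_error \<Theta>0 n (K n) \<le> ennreal (exp (- c * real n))" if n: "n > n0" for n
    unfolding type1_error_def
  proof (rule SUP_least)
    fix P assume P0: "P \<in> \<Theta>0"
    then have P: "P \<in> prob_measures" using \<Theta> by blast
    obtain G where G: "G \<in> \<G>" "\<And>g. g \<in> G \<Longrightarrow> \<bar>integral\<^sup>L P g\<bar> < 1"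
      using sep0[OF P0] by blast
    have "R n \<subseteq> dev n P"
    proof
      fix x assume x: "x \<in> R n"
      then obtain g where g: "g \<in> G" "\<bar>\<Sum>i\<in>{1..n}. g (x i)\<bar> \<ge> 3 / 2 * real n"
        using G(1) by (auto simp: R_def)
      have "\<bar>real n * integral\<^sup>L P g\<bar> \<le> real n"
        using G(2)[OF g(1)] by (simp add: abs_mult mult_left_le)
      then have "\<bar>(\<Sum>i\<in>{1..n}. g (x i)) - real n * integral\<^sup>L P g\<bar> \<ge> real n * (1 / 2)"
        using g(2) by linarith
      moreover have "g \<in> F" using g G by (auto simp: F_def)
      moreover have "x \<in> space (PiM {1..n} (\<lambda>_. P))"
        using x unfolding sp[OF P] by (simp add: R_def)
      ultimately show "x \<in> dev n P"
        unfolding dev_def card_atLeastAtMost by auto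
    qed
    then have "emeasure (PiM {1..n} (\<lambda>_. P)) (R n) \<le> ennreal (exp (- c * real n))"
      by (rule small[OF P n])
    moreover have "(\<integral>\<^sup>+x. ennreal (K n x) \<partial>PiM {1..n} (\<lambda>_. P)) = emeasure (PiM {1..n} (\<lambda>_. P)) (R n)"
      unfolding K_def ennreal_indicator
      by (rule nn_integral_indicator) (simp only: st[OF P] R_sets)
    ultimately show "(\<integral>\<^sup>+x. ennreal (K n x) \<partial>PiM {1..n} (\<lambda>_. P)) \<le> ennreal (exp (- c * real n))"
      by simp
  qed
  moreover have "type2_error \<Theta>1 n (K n) \<le> ennreal (exp (- c * real n))" if n: "n > n0" for n
    unfolding type2_error_def
  proof (rule SUP_least)
    fix P assume P1: "P \<in> \<Theta>1"
    then have P: "P \<in> prob_measures" using \<Theta> by blast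
    let ?A = "space (PiM {1..n} (\<lambda>_. P)) - R n"
    have "?A \<subseteq> dev n P"
    proof
      fix x assume x: "x \<in> ?A"
      then obtain G where G: "G \<in> \<G>" "\<And>g. g \<in> G \<Longrightarrow> \<bar>\<Sum>i\<in>{1..n}. g (x i)\<bar> < 3 / 2 * real n"
        unfolding R_def sp[OF P] by (auto simp: not_le simp del: One_nat_def)
      obtain g where g: "g \<in> G" "2 \<le> \<bar>integral\<^sup>L P g\<bar>"
        using sep1[OF P1] G(1) by blast
      have "real n * 2 \<le> \<bar>real n * integral\<^sup>L P g\<bar>"
        using g(2) by (simp add: abs_mult mult_left_mono)
      then have "\<bar>(\<Sum>i\<in>{1..n}. g (x i)) - real n * integral\<^sup>L P g\<bar> \<ge> real n * (1 / 2)"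
        using G(2)[OF g(1)] by linarith
      moreover have "g \<in> F" using g G by (auto simp: F_def)
      ultimately show "x \<in> dev n P"
        using x unfolding dev_def card_atLeastAtMost by auto
    qed
    then have "emeasure (PiM {1..n} (\<lambda>_. P)) ?A \<le> ennreal (exp (- c * real n))"
      by (rule small[OF P n])
    moreover have "(\<integral>\<^sup>+x. ennreal (1 - K n x) \<partial>PiM {1..n} (\<lambda>_. P)) =
        (\<integral>\<^sup>+x. indicator ?A x \<partial>PiM {1..n} (\<lambda>_. P))"
      unfolding K_def by (intro nn_integral_cong) (auto simp: indicator_def)
    moreover have "\<dots> = emeasure (PiM {1..n} (\<lambda>_. P)) ?A"
      by (rule nn_integral_indicator) (intro sets.compl_sets, simp only: st[OF P] R_sets)
    ultimately show "(\<integral>\<^sup>+x. ennreal (1 - K n x) \<partial>PiM {1..n} (\<lambda>_. P)) \<le> ennreal (exp (- c * real n))"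
      by simp
  qed
  ultimately show ?thesis
    unfolding exponentially_distinguishable_def using K_test c by blast
qed

theorem theorem2p4:
  fixes \<Theta>0 \<Theta>1 :: "'a::polish_space measure set"
  assumes "\<Theta>0 \<subseteq> prob_measures" and "\<Theta>1 \<subseteq> prob_measures"
  shows "(relatively_compact_in tau_topology \<Theta>0 \<and> relatively_compact_in tau_topology \<Theta>1 \<and>
           weak_topology closure_of \<Theta>0 \<inter> weak_topology closure_of \<Theta>1 \<noteq> {}
           \<longrightarrow> indistinguishable \<Theta>0 \<Theta>1) \<and>
         ((relatively_compact_in weak_topology \<Theta>0 \<or> relatively_compact_in weak_topology \<Theta>1) \<and>
           weak_topology closure_of \<Theta>0 \<inter> weak_topology closure_of \<Theta>1 = {}
           \<longrightarrow> distinguishable \<Theta>0 \<Theta>1 \<and>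
               (\<exists>(K :: nat \<Rightarrow> (nat \<Rightarrow> 'a) \<Rightarrow> real) (c::real) (n\<^sub>0::nat).
                  (\<forall>n\<ge>1. is_test n (K n)) \<and> c > 0 \<and>
                  (\<forall>n>n\<^sub>0. type1_error \<Theta>0 n (K n) \<le> ennreal (exp (- c * real n)) \<and>
                          type2_error \<Theta>1 n (K n) \<le> ennreal (exp (- c * real n)))))"
proof (intro conjI impI; (elim conjE)?)
  assume "relatively_compact_in tau_topology \<Theta>0" "relatively_compact_in tau_topology \<Theta>1"
    "weak_topology closure_of \<Theta>0 \<inter> weak_topology closure_of \<Theta>1 \<noteq> {}"
  then show "indistinguishable \<Theta>0 \<Theta>1"
    by (rule tau_compact_indistinguishable[OF assms])
next
  assume compact: "relatively_compact_in weak_topology \<Theta>0 \<or> relatively_compact_in weak_topology \<Theta>1"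
    and disj: "weak_topology closure_of \<Theta>0 \<inter> weak_topology closure_of \<Theta>1 = {}"
  have disj': "weak_topology closure_of \<Theta>1 \<inter> weak_topology closure_of \<Theta>0 = {}"
    using disj by (simp only: Int_commute)
  have exp: "exponentially_distinguishable \<Theta>0 \<Theta>1"
    using compact
  proof
    assume "relatively_compact_in weak_topology \<Theta>0"
    then show ?thesis
      using disj by (rule weak_compact_exponentially_distinguishable[OF assms])
  next
    assume "relatively_compact_in weak_topology \<Theta>1"
    then show ?thesis
      using disj' by (rule exponentially_distinguishable_sym[OF
          weak_compact_exponentially_distinguishable[OF assms(2,1)]])
  qed
  then show "distinguishable \<Theta>0 \<Theta>1"
    by (rule exponentially_distinguishable_imp_distinguishable)
  show "\<exists>(K :: nat \<Rightarrow> (nat \<Rightarrow> 'a) \<Rightarrow> real) (c::real) (n\<^sub>0::nat).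
      (\<forall>n\<ge>1. is_test n (K n)) \<and> c > 0 \<and>
      (\<forall>n>n\<^sub>0. type1_error \<Theta>0 n (K n) \<le> ennreal (exp (- c * real n)) \<and>
              type2_error \<Theta>1 n (K n) \<le> ennreal (exp (- c * real n)))"
    using exp unfolding exponentially_distinguishable_def .
qed

end
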